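(* Let $H=(X,E)$ and $L=(Y,F)$ be connected, locally finite graphs. Assume that $H$ is infinite and has at most two ends, that $L$ has at least one edge, and that $L$ has at most two ends. Then for every $p\in[1,\infty)$, every harmonic function $f$ on the vertices of the lamplighter graph $L\wr H$ whose gradient $\nabla f$ belongs to $\ell^p$ is constant.
   Context: Graphs are simple, undirected and connected; $v\sim w$ denotes adjacency. Ends: an end of a graph is a function $\xi$ assigning to each finite set $K$ of vertices an infinite connected component $\xi(K)$ of the complement of $K$, such that $\xi(K)\cap\xi(K')\neq\varnothing$ for all finite $K,K'$. A finite graph has no ends, so "at most two ends" includes finite graphs. Lamplighter graph: given $H=(X,E)$ (the space graph) and $L=(Y,F)$ (the lamp graph), fix a root vertex $o\in Y$ and let $\bigoplus_X Y$ be the set of functions $X\to Y$ which take the value $o$ at all but finitely many elements of $X$. The vertex set of $L\wr H$ is $X\times\bigoplus_X Y$. Two vertices $(x,f)$ and $(x',f')$ are adjacent if either (i) $x\sim x'$ in $H$ and $f=f'$; or (ii) $x=x'$, $f(y)=f'(y)$ for all $y\neq x$, and $f(x)\sim f'(x)$ in $L$. Harmonic functions: a real-valued function $f$ on the vertex set $V$ of a locally finite graph is harmonic if $f(v)=\frac{1}{\deg(v)}\sum_{w\sim v}f(w)$ for all $v\in V$, where $\deg(v)$ is the degree of $v$. The gradient of $f$ is the function on edges $(v,w)$ given by $\nabla f(v,w)=f(w)-f(v)$; it is in $\ell^p$ if $\sum_{(v,w)}|f(w)-f(v)|^p<\infty$, the sum being over all edges. *)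

theory Defs
  imports "HOL-Analysis.Analysis" "Graph_Theory.Graph_Theory"
begin

text \<open>
  A simple undirected graph, finite or infinite, is a \<^locale>\<open>pair_bidirected_digraph\<close>: a vertex
  set together with a symmetric, irreflexive set of ordered pairs of vertices.  An undirected edge
  thus appears as two arcs.  Since the arc set is symmetric, the strongly connected components
  (\<^const>\<open>pre_digraph.sccs_verts\<close>) are the connected components, and the out-degree is the degree.
\<close>

definition locally_finite :: "'a pair_pre_digraph \<Rightarrow> bool" where
  "locally_finite G \<longleftrightarrow> (\<forall>v \<in> pverts G. finite (out_arcs (with_proj G) v))"

definition complement_components :: "'a pair_pre_digraph \<Rightarrow> 'a set \<Rightarrow> 'a set set" where
  "complement_components G K = pre_digraph.sccs_verts (with_proj G \<restriction> (pverts G - K))"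

text \<open>
  The domain of an end is the set of finite sets of vertices.  The extensional function space fixes
  the values outside this domain, so that distinct elements are distinct ends.
\<close>

definition graph_ends :: "'a pair_pre_digraph \<Rightarrow> ('a set \<Rightarrow> 'a set) set" where
  "graph_ends G =
     {\<xi> \<in> (\<Pi>\<^sub>E K \<in> Fpow (pverts G). {C \<in> complement_components G K. infinite C}).
        \<forall>K \<in> Fpow (pverts G). \<forall>K' \<in> Fpow (pverts G). \<xi> K \<inter> \<xi> K' \<noteq> {}}"

definition at_most_two_ends :: "'a pair_pre_digraph \<Rightarrow> bool" where
  "at_most_two_ends G \<longleftrightarrow> finite (graph_ends G) \<and> card (graph_ends G) \<le> 2"

definition lamp_configs :: "'a set \<Rightarrow> 'b set \<Rightarrow> 'b \<Rightarrow> ('a \<Rightarrow> 'b) set" where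
  "lamp_configs X Y r = {f \<in> X \<rightarrow>\<^sub>E Y. finite {x \<in> X. f x \<noteq> r}}"

text \<open>The lamplighter graph with lamp graph \<open>L\<close>, root \<open>r\<close> of \<open>L\<close>, and space graph \<open>H\<close>.\<close>

definition lamplighter ::
    "'b pair_pre_digraph \<Rightarrow> 'b \<Rightarrow> 'a pair_pre_digraph \<Rightarrow> ('a \<times> ('a \<Rightarrow> 'b)) pair_pre_digraph" where
  "lamplighter L r H =
     (let V = pverts H \<times> lamp_configs (pverts H) (pverts L) r in
      \<lparr> pverts = V,
        parcs = {((x, f), (x', f')) | x f x' f'. (x, f) \<in> V \<and> (x', f') \<in> V \<and>
          ((x, x') \<in> parcs H \<and> f = f' \<or>
           x = x' \<and> (\<forall>y \<in> pverts H. y \<noteq> x \<longrightarrow> f y = f' y) \<and> (f x, f' x) \<in> parcs L)} \<rparr>)"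

lemma pair_bidirected_digraph_lamplighter:
  assumes "pair_bidirected_digraph L" "pair_bidirected_digraph H"
  shows "pair_bidirected_digraph (lamplighter L r H)"
proof -
  interpret L: pair_bidirected_digraph L by fact
  interpret H: pair_bidirected_digraph H by fact
  have symL: "(b, a) \<in> parcs L" if "(a, b) \<in> parcs L" for a b
    using L.pair_sym_arcs that by (simp add: symmetric_def sym_def)
  have symH: "(b, a) \<in> parcs H" if "(a, b) \<in> parcs H" for a b
    using H.pair_sym_arcs that by (simp add: symmetric_def sym_def)
  have "sym (parcs (lamplighter L r H))"
    by (rule symI) (auto simp: lamplighter_def Let_def intro: symL symH)
  then show ?thesis
    by unfold_locales
       (auto simp: lamplighter_def Let_def symmetric_def
             dest: L.pair_no_loops H.pair_no_loops)
qed

definition harmonic :: "'a pair_pre_digraph \<Rightarrow> ('a \<Rightarrow> real) \<Rightarrow> bool" where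
  "harmonic G f \<longleftrightarrow>
     (\<forall>v \<in> pverts G. f v = 1 / real (out_degree (with_proj G) v) * (\<Sum>w | (v, w) \<in> parcs G. f w))"

definition gradient :: "('a \<Rightarrow> real) \<Rightarrow> 'a \<times> 'a \<Rightarrow> real" where
  "gradient f = (\<lambda>(v, w). f w - f v)"

definition in_ell_p :: "real \<Rightarrow> 'e set \<Rightarrow> ('e \<Rightarrow> real) \<Rightarrow> bool" where
  "in_ell_p p E g \<longleftrightarrow> (\<lambda>e. \<bar>g e\<bar> powr p) summable_on E"

end

theory Submission
  imports Defs
begin

text \<open>
  The gradient hypothesis alone makes a function on the lamplighter graph nearly constant off a
  finite set of vertices; harmonicity is used only to carry this into the finite set, by the
  maximum principle.

  The mechanism is that walking while randomising lamps spreads mass exponentially fast.  Choose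
  a neighbour \<open>other a\<close> of each lamp state \<open>a\<close>.  For a
  finite set \<open>R\<close> of sites let \<open>avg x \<phi> R\<close> be the mean of \<open>f (x, \<psi>)\<close> over the
  \<open>2 ^ card R\<close> configurations \<open>\<psi>\<close> obtained from \<open>\<phi>\<close> by switching the lamps of
  some subset of \<open>R\<close> to their chosen neighbours.  If all these vertices make the same step, then
  \<open>2 ^ card R\<close> different arcs are crossed, and the power mean inequality bounds the change of the
  average by a constant times \<open>\<epsilon> * q ^ card R\<close>, where \<open>q = 2 powr (- 1 / p) < 1\<close> and
  \<open>\<epsilon>\<close> bounds the \<open>p\<close>-norm of the gradient on the arcs in question.  Adding a site at
  distance \<open>n\<close> to \<open>R\<close> (walk there, switch the lamp, walk back) therefore costs at most
  \<open>2 * n + 1\<close> such steps.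

  This is used twice.  First, an infinite connected graph has more than \<open>k\<close> vertices within
  distance \<open>k\<close> of any vertex \<open>x\<close>, so one can add distinct sites
  \<open>s 0, s 1, \<dots>\<close> with \<open>s k\<close> at distance at most \<open>k + 1\<close> from \<open>x\<close>.  The
  costs \<open>O (k * \<epsilon> * q ^ k)\<close> are summable, so \<open>f (x, \<phi>)\<close> differs from its average
  over the first \<open>N\<close> sites by \<open>O (\<epsilon>)\<close>, uniformly in \<open>N\<close> and in the starting
  vertex (\<open>near_sites_bound\<close>).  Second, the averages belonging to two different starting vertices
  merge: each can be extended to the union of both families of sites, and then be moved to the other
  starting vertex, with costs \<open>O (N ^ 2 * q ^ N)\<close> (\<open>avg_sites_tendsto\<close>).  Hence any two
  values of \<open>f\<close> differ by \<open>O (\<epsilon>)\<close>.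

  To make \<open>\<epsilon>\<close> small, the arcs crossed in the first part must avoid a finite set \<open>T\<close> that
  carries almost all of the gradient.  This is arranged by a marker: a site \<open>z\<close> whose lamp is in a
  state that it has in no configuration occurring in \<open>T\<close>.  As long as the lamp at \<open>z\<close> is left
  alone, no arc of \<open>T\<close> can be met.  Off a finite set of vertices, a marker is either present or can
  be created by switching the lamp at the current position (\<open>nearly_marked_cofinite\<close>).
\<close>

section \<open>Energy and the maximum principle\<close>

text \<open>
  The power mean inequality, up to the factor 2.  With \<open>\<delta>\<close> the right-hand side without that
  factor, the values up to \<open>\<delta>\<close> contribute at most \<open>\<delta>\<close> to the mean, and so do the larger
  values, because there \<open>t \<le> t powr p * \<delta> powr (1 - p)\<close>.
\<close>

lemma mean_le_of_sum_powr_le: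
  fixes g :: "'i \<Rightarrow> real"
  assumes "finite I" "card I = 2 ^ k" "1 \<le> p" "0 < \<epsilon>"
    and le: "(\<Sum>i\<in>I. \<bar>g i\<bar> powr p) \<le> \<epsilon> powr p"
  shows "(\<Sum>i\<in>I. \<bar>g i\<bar>) / 2 ^ k \<le> 2 * \<epsilon> * (2 powr (- 1 / p)) ^ k"
proof -
  define \<delta> where "\<delta> = \<epsilon> * (2 powr (- 1 / p)) ^ k"
  have \<delta>: "0 < \<delta>" using assms by (simp add: \<delta>_def)
  have \<delta>p: "\<epsilon> powr p = \<delta> powr p * 2 ^ k"
  proof -
    have "(2 powr (- 1 / p)) ^ k = 2 powr (- real k / p)"
      by (simp add: powr_power)
    then have "((2 powr (- 1 / p)) ^ k) powr p = 2 powr (- real k)"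
      using assms by (simp add: powr_powr)
    then have "\<delta> powr p = \<epsilon> powr p * 2 powr (- real k)"
      using assms by (simp add: \<delta>_def powr_mult)
    moreover have "2 powr (- real k) * 2 ^ k = (1::real)"
      by (simp add: powr_minus powr_realpow)
    ultimately show ?thesis by simp
  qed
  have pt: "t \<le> \<delta> + t powr p * \<delta> powr (1 - p)" if "0 \<le> t" for t
  proof (cases "t \<le> \<delta>")
    case False
    then have "t powr (1 - p) \<le> \<delta> powr (1 - p)"
      using \<delta> assms by (intro powr_mono2') auto
    then have "t powr p * t powr (1 - p) \<le> t powr p * \<delta> powr (1 - p)"
      by (intro mult_left_mono) auto
    moreover have "t powr p * t powr (1 - p) = t"
      using False \<delta> by (simp flip: powr_add)
    ultimately show ?thesis using \<delta> by linarith
  qed (use \<delta> in \<open>auto intro: add_increasing2\<close>)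
  have "(\<Sum>i\<in>I. \<bar>g i\<bar>) \<le> (\<Sum>i\<in>I. \<delta> + \<bar>g i\<bar> powr p * \<delta> powr (1 - p))"
    by (intro sum_mono pt) auto
  also have "\<dots> = 2 ^ k * \<delta> + (\<Sum>i\<in>I. \<bar>g i\<bar> powr p) * \<delta> powr (1 - p)"
    using assms by (simp add: sum.distrib sum_distrib_right)
  also have "\<dots> \<le> 2 ^ k * \<delta> + \<delta> powr p * 2 ^ k * \<delta> powr (1 - p)"
    using le unfolding \<delta>p by (intro add_left_mono mult_right_mono) auto
  also have "\<delta> powr p * 2 ^ k * \<delta> powr (1 - p) = 2 ^ k * \<delta>"
    using \<delta> by (simp add: algebra_simps flip: powr_add)
  finally show ?thesis by (simp add: \<delta>_def field_simps)
qed

text \<open>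
  The \<open>p\<close>-norm of \<open>g\<close> on \<open>E\<close> is at most \<open>\<epsilon>\<close>.  Only finite subsets are
  mentioned, so that the bound applies directly to the arcs crossed by one step of an average.
\<close>

definition energy_le :: "real \<Rightarrow> 'e set \<Rightarrow> ('e \<Rightarrow> real) \<Rightarrow> real \<Rightarrow> bool" where
  "energy_le p E g \<epsilon> \<longleftrightarrow>
     (\<forall>T. finite T \<longrightarrow> T \<subseteq> E \<longrightarrow> (\<Sum>e\<in>T. \<bar>g e\<bar> powr p) \<le> \<epsilon> powr p)"

lemma energy_le_mono: "energy_le p E g \<epsilon> \<Longrightarrow> E' \<subseteq> E \<Longrightarrow> energy_le p E' g \<epsilon>"
  by (auto simp: energy_le_def)

lemma energy_le_tail:
  assumes "in_ell_p p E g" "0 < \<epsilon>"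
  obtains T where "finite T" "T \<subseteq> E" "energy_le p (E - T) g \<epsilon>"
proof -
  let ?h = "\<lambda>e. \<bar>g e\<bar> powr p"
  obtain I where I: "(?h has_sum I) E"
    using assms(1) by (auto simp: in_ell_p_def summable_on_def)
  have "\<forall>\<^sub>F T in finite_subsets_at_top E. I - \<epsilon> powr p < sum ?h T"
    using I assms(2) by (intro order_tendstoD(1)[of _ I]) (auto simp: has_sum_def)
  then obtain T where T: "finite T" "T \<subseteq> E" "I - \<epsilon> powr p < sum ?h T"
    by (auto simp: eventually_finite_subsets_at_top)
  have "sum ?h T' \<le> \<epsilon> powr p" if "finite T'" "T' \<subseteq> E - T" for T'
  proof -
    have "sum ?h (T \<union> T') \<le> I"
      using T that by (intro has_sum_mono_neutral[OF has_sum_finite I]) auto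
    moreover have "sum ?h (T \<union> T') = sum ?h T + sum ?h T'"
      using T that by (intro sum.union_disjoint) auto
    ultimately show ?thesis using T(3) by simp
  qed
  then show thesis using that T by (auto simp: energy_le_def)
qed

lemma energy_le_total:
  assumes "in_ell_p p E g" "1 \<le> p"
  obtains \<epsilon> where "0 < \<epsilon>" "energy_le p E g \<epsilon>"
proof -
  let ?h = "\<lambda>e. \<bar>g e\<bar> powr p"
  obtain I where I: "(?h has_sum I) E"
    using assms(1) by (auto simp: in_ell_p_def summable_on_def)
  define \<epsilon> where "\<epsilon> = (\<bar>I\<bar> + 1) powr (1 / p)"
  have "sum ?h T \<le> \<epsilon> powr p" if "finite T" "T \<subseteq> E" for T
  proof -
    have "sum ?h T \<le> I"
      using that by (intro has_sum_mono_neutral[OF has_sum_finite I]) auto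
    also have "I \<le> \<epsilon> powr p" using assms by (simp add: \<epsilon>_def powr_powr)
    finally show ?thesis .
  qed
  moreover have "0 < \<epsilon>" by (simp add: \<epsilon>_def)
  ultimately show thesis using that by (auto simp: energy_le_def)
qed

lemma harmonic_uminus: "harmonic G f \<Longrightarrow> harmonic G (\<lambda>v. - f v)"
  by (simp add: harmonic_def sum_negf)

text \<open>
  Since only finitely many values exceed \<open>t\<close>, a value above \<open>t\<close> would force a global maximum
  above \<open>t\<close> to be attained.  The mean value property spreads this maximum to all neighbours and
  hence, by connectedness, to \<open>w\<close>.
\<close>

lemma maximum_principle:
  assumes harm: "harmonic G f"
    and arcs: "parcs G \<subseteq> pverts G \<times> pverts G"
    and fin: "\<And>v. v \<in> pverts G \<Longrightarrow> finite {w. (v, w) \<in> parcs G}"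
    and conn: "\<And>u v. u \<in> pverts G \<Longrightarrow> v \<in> pverts G \<Longrightarrow> (u, v) \<in> (parcs G)\<^sup>*"
    and w: "w \<in> pverts G" "f w \<le> t"
    and finite_above: "finite {v \<in> pverts G. t < f v}"
    and u: "u \<in> pverts G"
  shows "f u \<le> t"
proof (rule ccontr)
  let ?S = "{v \<in> pverts G. t < f v}"
  assume "\<not> f u \<le> t"
  then have ne: "?S \<noteq> {}" using u by auto
  define M where "M = Max (f ` ?S)"
  have "M \<in> f ` ?S" unfolding M_def using finite_above ne by (intro Max_in) auto
  then obtain m where m: "m \<in> pverts G" "t < f m" "f m = M" by auto
  have M: "f v \<le> M" if "v \<in> pverts G" for v
  proof (cases "t < f v")
    case True
    then show ?thesis unfolding M_def using that finite_above by (intro Max_ge) auto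
  qed (use m in linarith)
  have "f w' = M" if "(m, w') \<in> (parcs G)\<^sup>*" for w'
    using that
  proof induction
    case (step v v')
    let ?N = "{w. (v, w) \<in> parcs G}"
    have v: "v \<in> pverts G" using step arcs by auto
    have "out_arcs (with_proj G) v = Pair v ` ?N" by (auto simp: out_arcs_def)
    then have deg: "out_degree (with_proj G) v = card ?N"
      by (simp add: out_degree_def card_image inj_on_def)
    have pos: "0 < card ?N" using step fin[OF v] by (auto simp: card_gt_0_iff)
    have "f v = 1 / real (card ?N) * sum f ?N"
      using harm v by (simp add: harmonic_def flip: deg)
    then have "(\<Sum>w\<in>?N. M - f w) = 0"
      using pos step by (simp add: sum_subtractf field_simps)
    moreover have "0 \<le> M - f w" if "w \<in> ?N" for w using M[of w] that arcs by auto
    ultimately have "\<forall>w\<in>?N. M - f w = 0"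
      using fin[OF v] by (subst (asm) sum_nonneg_eq_0_iff) auto
    then show ?case using step by auto
  qed (use m in simp)
  then have "f w = M" using conn m(1) w(1) by blast
  then show False using w m by simp
qed

lemma connected_rtrancl:
  assumes "pair_bidirected_digraph G" "Digraph_Component.connected (with_proj G)"
    "u \<in> pverts G" "v \<in> pverts G"
  shows "(u, v) \<in> (parcs G)\<^sup>*"
proof -
  interpret pair_bidirected_digraph G by fact
  have "strongly_connected (with_proj G)"
    using assms(2) by (intro symmetric_connected_imp_strongly_connected sym_arcs)
  then have "u \<rightarrow>\<^sup>*\<^bsub>with_proj G\<^esub> v" using assms(3,4) by (auto simp: strongly_connected_def)
  then have "(u, v) \<in> (arcs_ends (with_proj G))\<^sup>*"
    unfolding reachable_def by (rule rtrancl_on_rtranclI)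
  then show ?thesis by (simp add: arcs_ends_def arc_to_ends_def)
qed

section \<open>Many sites close to a given vertex\<close>

text \<open>
  Balls grow strictly: a ball equal to the next one would be closed under the relation, hence contain
  the infinite set \<open>X\<close>.
\<close>

lemma less_card_of_ball_subset:
  assumes conn: "\<And>y. y \<in> X \<Longrightarrow> (x, y) \<in> A\<^sup>*" and "infinite X"
    and "finite F" "{y. \<exists>m\<le>n. (x, y) \<in> A ^^ m} \<subseteq> F"
  shows "n < card F"
  using assms(3,4)
proof (induction n arbitrary: F)
  case 0
  then show ?case by (auto simp: card_gt_0_iff)
next
  case (Suc n)
  let ?B = "\<lambda>n. {y. \<exists>m\<le>n. (x, y) \<in> A ^^ m}"
  have mono: "?B n \<subseteq> ?B (Suc n)" by (auto intro: le_SucI)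
  have "\<not> ?B (Suc n) \<subseteq> ?B n"
  proof
    assume closed: "?B (Suc n) \<subseteq> ?B n"
    have "y \<in> ?B n" if "(x, y) \<in> A\<^sup>*" for y
      using that
    proof induction
      case (step y z)
      then obtain m where "m \<le> n" "(x, y) \<in> A ^^ m" by auto
      then have "z \<in> ?B (Suc n)" using step by (auto intro!: exI[of _ "Suc m"])
      then show ?case using closed by blast
    qed (auto intro!: exI[of _ 0])
    then have "X \<subseteq> ?B n" using conn by blast
    then have "X \<subseteq> F" using mono Suc.prems by blast
    then show False using Suc.prems \<open>infinite X\<close> finite_subset by blast
  qed
  then obtain y where y: "y \<in> ?B (Suc n)" "y \<notin> ?B n" by blast
  have "?B n \<subseteq> F - {y}" using y(2) mono Suc.prems by blast
  then have "n < card (F - {y})" using Suc.prems by (intro Suc.IH) auto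
  moreover have "y \<in> F" using y Suc.prems by blast
  ultimately show ?case using Suc.prems by simp
qed

text \<open>
  A greedy choice.  The ball of radius \<open>k + 1\<close> has at least \<open>k + 2\<close> elements, which leaves room
  to avoid the \<open>k\<close> earlier sites and the forbidden site \<open>z\<close>, later the position of a marker.
\<close>

lemma exists_near_sites:
  assumes "\<And>y. y \<in> X \<Longrightarrow> (x, y) \<in> A\<^sup>*" "infinite X"
  obtains s :: "nat \<Rightarrow> 'a"
  where "inj s" "\<And>k. s k \<noteq> z" "\<And>k. \<exists>m\<le>Suc k. (x, s k) \<in> A ^^ m"
proof -
  let ?P = "\<lambda>s k y. (\<exists>m\<le>Suc k. (x, y) \<in> A ^^ m) \<and> y \<notin> insert z (s ` {..<k})"
  have "\<exists>s. \<forall>k. ?P s k (s k)"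
  proof (rule dependent_wellorder_choice)
    fix k :: nat and s :: "nat \<Rightarrow> 'a"
    let ?F = "insert z (s ` {..<k})"
    have "card ?F \<le> Suc (card (s ` {..<k}))" by (simp add: card_insert_if)
    also have "\<dots> \<le> Suc k" using card_image_le[of "{..<k}" s] by simp
    finally have "\<not> {y. \<exists>m\<le>Suc k. (x, y) \<in> A ^^ m} \<subseteq> ?F"
      using less_card_of_ball_subset[OF assms, of ?F "Suc k"] by auto
    then show "\<exists>y. ?P s k y" by blast
  qed auto
  then obtain s where s: "\<And>k. ?P s k (s k)" by blast
  have "inj s"
  proof (rule linorder_injI)
    fix j k :: nat assume "j < k"
    then show "s j \<noteq> s k" using s[of k] by (metis imageI insertCI lessThan_iff)
  qed
  then show thesis using that s by auto
qed

section \<open>Arcs and paths of the lamplighter graph\<close>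

locale lamplighter_function =
  H: pair_bidirected_digraph H + L: pair_bidirected_digraph L
  for H :: "'a pair_pre_digraph" and L :: "'b pair_pre_digraph" +
  fixes r :: 'b and p :: real and f :: "'a \<times> ('a \<Rightarrow> 'b) \<Rightarrow> real"
  assumes H_connected: "Digraph_Component.connected (with_proj H)"
    and L_connected: "Digraph_Component.connected (with_proj L)"
    and L_nontrivial: "parcs L \<noteq> {}"
    and root: "r \<in> pverts L"
    and p_ge_1: "1 \<le> p"
begin

abbreviation "X \<equiv> pverts H"
abbreviation "Conf \<equiv> lamp_configs (pverts H) (pverts L) r"
abbreviation "G \<equiv> lamplighter L r H"

lemma H_arc_ends: "(x, y) \<in> parcs H \<Longrightarrow> x \<in> X \<and> y \<in> X"
  using H.arc_fst_in_verts H.arc_snd_in_verts by fastforce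

lemma L_arc_ends: "(a, b) \<in> parcs L \<Longrightarrow> a \<in> pverts L \<and> b \<in> pverts L"
  using L.arc_fst_in_verts L.arc_snd_in_verts by fastforce

lemma pverts_G: "pverts G = X \<times> Conf"
  by (simp add: lamplighter_def Let_def)

lemma arc_G_iff:
  "((x, \<phi>), (x', \<phi>')) \<in> parcs G \<longleftrightarrow> x \<in> X \<and> x' \<in> X \<and> \<phi> \<in> Conf \<and> \<phi>' \<in> Conf \<and>
     ((x, x') \<in> parcs H \<and> \<phi> = \<phi>' \<or>
      x = x' \<and> (\<forall>y\<in>X. y \<noteq> x \<longrightarrow> \<phi> y = \<phi>' y) \<and> (\<phi> x, \<phi>' x) \<in> parcs L)"
  by (auto simp: lamplighter_def Let_def)

lemma parcs_G_subset: "parcs G \<subseteq> pverts G \<times> pverts G"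
  by (auto simp: pverts_G arc_G_iff)

lemma config_update:
  assumes "\<phi> \<in> Conf" "x \<in> X" "b \<in> pverts L"
  shows "\<phi>(x := b) \<in> Conf"
proof -
  have "{y \<in> X. (\<phi>(x := b)) y \<noteq> r} \<subseteq> insert x {y \<in> X. \<phi> y \<noteq> r}" by auto
  then have "finite {y \<in> X. (\<phi>(x := b)) y \<noteq> r}"
    by (rule finite_subset) (use assms in \<open>auto simp: lamp_configs_def\<close>)
  then show ?thesis using assms by (auto simp: lamp_configs_def PiE_def extensional_def)
qed

lemma move_arc: "(x, y) \<in> parcs H \<Longrightarrow> \<phi> \<in> Conf \<Longrightarrow> ((x, \<phi>), (y, \<phi>)) \<in> parcs G"
  using H_arc_ends by (fastforce simp: arc_G_iff)

lemma lamp_arc: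
  assumes "\<phi> \<in> Conf" "x \<in> X" "(\<phi> x, b) \<in> parcs L"
  shows "((x, \<phi>), (x, \<phi>(x := b))) \<in> parcs G"
proof -
  have "b \<in> pverts L" using assms(3) L_arc_ends by fastforce
  then show ?thesis using assms config_update by (auto simp: arc_G_iff)
qed

lemma arc_G_cases:
  assumes "((x, \<phi>), v) \<in> parcs G"
  obtains y where "v = (y, \<phi>)" "(x, y) \<in> parcs H"
  | b where "v = (x, \<phi>(x := b))" "(\<phi> x, b) \<in> parcs L"
proof -
  obtain x' \<phi>' where v: "v = (x', \<phi>')" by (cases v)
  note a = assms[unfolded v arc_G_iff]
  have "\<phi>' = \<phi>(x := \<phi>' x)" if "\<forall>y\<in>X. y \<noteq> x \<longrightarrow> \<phi> y = \<phi>' y"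
  proof
    fix y
    show "\<phi>' y = (\<phi>(x := \<phi>' x)) y"
      using that a by (cases "y \<in> X") (auto simp: lamp_configs_def PiE_def extensional_def)
  qed
  then show thesis using that v a by metis
qed

lemma finite_neighbours_G:
  assumes "locally_finite H" "locally_finite L" "v \<in> pverts G"
  shows "finite {w. (v, w) \<in> parcs G}"
proof -
  obtain x \<phi> where v: "v = (x, \<phi>)" "x \<in> X" "\<phi> \<in> Conf" using assms(3) by (auto simp: pverts_G)
  have nbr: "finite {w. (u, w) \<in> parcs K}"
    if "locally_finite K" "u \<in> pverts K" for K :: "'c pair_pre_digraph" and u
  proof -
    have "{w. (u, w) \<in> parcs K} = snd ` out_arcs (with_proj K) u"
      by (force simp: out_arcs_def)
    then show ?thesis using that by (simp add: locally_finite_def)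
  qed
  have "\<phi> x \<in> pverts L" using v by (auto simp: lamp_configs_def)
  then have "finite ((\<lambda>y. (y, \<phi>)) ` {y. (x, y) \<in> parcs H} \<union>
      (\<lambda>b. (x, \<phi>(x := b))) ` {b. (\<phi> x, b) \<in> parcs L})"
    using assms v by (intro finite_UnI finite_imageI nbr)
  moreover have "{w. (v, w) \<in> parcs G} \<subseteq> (\<lambda>y. (y, \<phi>)) ` {y. (x, y) \<in> parcs H} \<union>
      (\<lambda>b. (x, \<phi>(x := b))) ` {b. (\<phi> x, b) \<in> parcs L}"
    unfolding v by (auto elim: arc_G_cases)
  ultimately show ?thesis by (rule rev_finite_subset)
qed

lemma walk_rtrancl:
  assumes "\<phi> \<in> Conf" "x \<in> X" "y \<in> X"
  shows "((x, \<phi>), (y, \<phi>)) \<in> (parcs G)\<^sup>*"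
proof -
  have "(x, y) \<in> (parcs H)\<^sup>*"
    using assms connected_rtrancl[OF H.pair_bidirected_digraph_axioms H_connected] by blast
  then show ?thesis
    by induction (use assms move_arc in \<open>auto intro: rtrancl_into_rtrancl\<close>)
qed

lemma change_lamp_rtrancl:
  assumes "\<phi> \<in> Conf" "x \<in> X" "y \<in> X" "b \<in> pverts L"
  shows "((x, \<phi>), (x, \<phi>(y := b))) \<in> (parcs G)\<^sup>*"
proof -
  have "\<phi> y \<in> pverts L" using assms by (auto simp: lamp_configs_def)
  then have "(\<phi> y, b) \<in> (parcs L)\<^sup>*"
    using assms connected_rtrancl[OF L.pair_bidirected_digraph_axioms L_connected] by blast
  then have "b \<in> pverts L \<and> ((y, \<phi>), (y, \<phi>(y := b))) \<in> (parcs G)\<^sup>*"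
  proof induction
    case (step a b)
    then have "((y, \<phi>(y := a)), (y, (\<phi>(y := a))(y := b))) \<in> parcs G"
      using assms config_update by (intro lamp_arc) auto
    then have "((y, \<phi>(y := a)), (y, \<phi>(y := b))) \<in> parcs G" by (simp only: fun_upd_upd)
    then show ?case using step L_arc_ends by (meson rtrancl_into_rtrancl)
  qed (use assms \<open>\<phi> y \<in> pverts L\<close> in auto)
  then show ?thesis
    using walk_rtrancl[of \<phi> x y] walk_rtrancl[of "\<phi>(y := b)" y x] config_update assms
    by (meson rtrancl_trans)
qed

lemma G_rtrancl:
  assumes "u \<in> pverts G" "v \<in> pverts G"
  shows "(u, v) \<in> (parcs G)\<^sup>*"
proof -
  obtain x \<phi> y \<psi> where uv: "u = (x, \<phi>)" "v = (y, \<psi>)" "x \<in> X" "y \<in> X" "\<phi> \<in> Conf" "\<psi> \<in> Conf"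
    using assms by (auto simp: pverts_G)
  have "((x, \<phi>), (x, \<psi>)) \<in> (parcs G)\<^sup>*"
    if "finite D" "\<phi> \<in> Conf" "D \<subseteq> X" "\<And>z. z \<notin> D \<Longrightarrow> \<phi> z = \<psi> z" for D \<phi>
    using that
  proof (induction D arbitrary: \<phi>)
    case empty
    then have "\<phi> = \<psi>" by auto
    then show ?case by simp
  next
    case (insert z D)
    have "\<psi> z \<in> pverts L" using insert uv by (auto simp: lamp_configs_def)
    then have 1: "((x, \<phi>), (x, \<phi>(z := \<psi> z))) \<in> (parcs G)\<^sup>*" "\<phi>(z := \<psi> z) \<in> Conf"
      using insert uv change_lamp_rtrancl config_update by auto
    moreover have "((x, \<phi>(z := \<psi> z)), (x, \<psi>)) \<in> (parcs G)\<^sup>*"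
      using insert.prems by (intro insert.IH 1) auto
    ultimately show ?case by (meson rtrancl_trans)
  qed
  moreover have "finite ({z \<in> X. \<phi> z \<noteq> r} \<union> {z \<in> X. \<psi> z \<noteq> r})"
    using uv by (auto simp: lamp_configs_def)
  moreover have "\<phi> z = \<psi> z" if "z \<notin> {z \<in> X. \<phi> z \<noteq> r} \<union> {z \<in> X. \<psi> z \<noteq> r}" for z
    using that uv by (cases "z \<in> X") (auto simp: lamp_configs_def PiE_def extensional_def)
  ultimately have "((x, \<phi>), (x, \<psi>)) \<in> (parcs G)\<^sup>*" using uv by blast
  then show ?thesis using walk_rtrancl uv by (meson rtrancl_trans)
qed

section \<open>Averages over lamp changes\<close>

definition other :: "'b \<Rightarrow> 'b" where
  "other a = (SOME b. (a, b) \<in> parcs L)"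

lemma other_arc:
  assumes "a \<in> pverts L"
  shows "(a, other a) \<in> parcs L"
proof -
  obtain u v where uv: "(u, v) \<in> parcs L" using L_nontrivial by auto
  then have "(a, u) \<in> (parcs L)\<^sup>*"
    using assms L_arc_ends
      connected_rtrancl[OF L.pair_bidirected_digraph_axioms L_connected] by fastforce
  then have "\<exists>b. (a, b) \<in> parcs L"
    by (cases rule: converse_rtranclE) (use uv in auto)
  then show ?thesis unfolding other_def by (rule someI_ex)
qed

lemma other_neq: "a \<in> pverts L \<Longrightarrow> other a \<noteq> a"
  using other_arc L.pair_no_loops by fastforce

definition flip :: "('a \<Rightarrow> 'b) \<Rightarrow> 'a set \<Rightarrow> 'a \<Rightarrow> 'b" where
  "flip \<phi> W = (\<lambda>y. if y \<in> W then other (\<phi> y) else \<phi> y)"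

lemma flip_empty [simp]: "flip \<phi> {} = \<phi>"
  by (simp add: flip_def)

lemma flip_insert: "y \<notin> W \<Longrightarrow> flip \<phi> (insert y W) = (flip \<phi> W)(y := other (\<phi> y))"
  by (auto simp: flip_def)

lemma flip_update: "y \<notin> W \<Longrightarrow> flip (\<phi>(y := b)) W = (flip \<phi> W)(y := b)"
  by (auto simp: flip_def)

lemma flip_other: "y \<notin> W \<Longrightarrow> flip \<phi> W y = \<phi> y"
  by (simp add: flip_def)

lemma flip_config:
  assumes "\<phi> \<in> Conf" "finite W" "W \<subseteq> X"
  shows "flip \<phi> W \<in> Conf"
  using assms(2,3)
proof induction
  case (insert y W)
  have "\<phi> y \<in> pverts L" using assms insert by (auto simp: lamp_configs_def)
  then have "other (\<phi> y) \<in> pverts L" using other_arc L_arc_ends by fastforce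
  then have "(flip \<phi> W)(y := other (\<phi> y)) \<in> Conf"
    using insert by (intro config_update) auto
  then show ?case using insert by (simp only: flip_insert not_False_eq_True)
qed (use assms in simp)

lemma inj_on_flip:
  assumes "\<phi> \<in> Conf" "R \<subseteq> X"
  shows "inj_on (flip \<phi>) (Pow R)"
proof (rule inj_onI)
  fix W W' assume W: "W \<in> Pow R" "W' \<in> Pow R" "flip \<phi> W = flip \<phi> W'"
  have "y \<in> W \<longleftrightarrow> y \<in> W'" if "y \<in> R" for y
  proof -
    have "\<phi> y \<in> pverts L" using that assms by (auto simp: lamp_configs_def)
    then show ?thesis using fun_cong[OF W(3), of y] other_neq[of "\<phi> y"]
      by (auto simp: flip_def split: if_splits)
  qed
  then show "W = W'" using W by blast
qed

text \<open>
  The position \<open>x\<close> is kept apart from the randomised sites \<open>R\<close>: every site is switched by a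
  round trip from \<open>x\<close>, so that averages over different sets of sites are compared at one position.
\<close>

definition avg :: "'a \<Rightarrow> ('a \<Rightarrow> 'b) \<Rightarrow> 'a set \<Rightarrow> real" where
  "avg x \<phi> R = (\<Sum>W\<in>Pow R. f (x, flip \<phi> W)) / 2 ^ card R"

lemma avg_empty [simp]: "avg x \<phi> {} = f (x, \<phi>)"
  by (simp add: avg_def)

lemma avg_insert:
  assumes "finite R" "y \<notin> R"
  shows "avg x \<phi> (insert y R) = (avg x \<phi> R + avg x (\<phi>(y := other (\<phi> y))) R) / 2"
proof -
  have "(\<Sum>W\<in>Pow (insert y R). f (x, flip \<phi> W)) =
      (\<Sum>W\<in>Pow R. f (x, flip \<phi> W)) + (\<Sum>W\<in>insert y ` Pow R. f (x, flip \<phi> W))"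
    unfolding Pow_insert using assms by (intro sum.union_disjoint) auto
  also have "(\<Sum>W\<in>insert y ` Pow R. f (x, flip \<phi> W)) = (\<Sum>W\<in>Pow R. f (x, flip \<phi> (insert y W)))"
    using assms by (subst sum.reindex) (auto simp: inj_on_def)
  also have "\<dots> = (\<Sum>W\<in>Pow R. f (x, flip (\<phi>(y := other (\<phi> y))) W))"
  proof (intro sum.cong refl)
    fix W assume "W \<in> Pow R"
    then have "y \<notin> W" using assms by blast
    then have "flip \<phi> (insert y W) = flip (\<phi>(y := other (\<phi> y))) W"
      by (auto simp: flip_def)
    then show "f (x, flip \<phi> (insert y W)) = f (x, flip (\<phi>(y := other (\<phi> y))) W)"
      by simp
  qed
  finally show ?thesis using assms by (simp add: avg_def field_simps)
qed

definition arcs_from :: "('a \<Rightarrow> 'b) set \<Rightarrow> (('a \<times> ('a \<Rightarrow> 'b)) \<times> ('a \<times> ('a \<Rightarrow> 'b))) set" where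
  "arcs_from D = {e \<in> parcs G. snd (fst e) \<in> D}"

definition q :: real where "q = 2 powr (- 1 / p)"

lemma q_pos: "0 < q" and q_less_1: "q < 1"
  using p_ge_1 by (auto simp: q_def powr_less_one)

lemma q_power_mono: "m \<le> n \<Longrightarrow> q ^ n \<le> q ^ m"
  using q_pos q_less_1 by (intro power_decreasing) auto

end

section \<open>The cost of randomising further sites\<close>

text \<open>
  The energy bound concerns only arcs that start in a configuration from \<open>D\<close>.  For a small
  \<open>\<epsilon>\<close> the set \<open>D\<close> consists of the configurations with a given marker; for the asymptotic
  comparisons any finite \<open>\<epsilon>\<close> will do, and \<open>D\<close> is everything.
\<close>

locale bounded_energy = lamplighter_function +
  fixes D :: "('a \<Rightarrow> 'b) set" and \<epsilon> :: real
  assumes eps_pos: "0 < \<epsilon>"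
    and energy: "energy_le p (arcs_from D) (gradient f) \<epsilon>"
begin

text \<open>
  The basic estimate: distinct subsets \<open>W\<close> give distinct starting vertices, so the
  \<open>2 ^ card R\<close> arcs crossed are distinct and share the energy \<open>\<epsilon>\<close>.
\<close>

lemma avg_step:
  assumes "\<phi> \<in> Conf" "finite R" "R \<subseteq> X" "flip \<phi> ` Pow R \<subseteq> D"
    and arc: "\<And>W. W \<subseteq> R \<Longrightarrow> ((x, flip \<phi> W), (x', flip \<phi>' W)) \<in> parcs G"
  shows "\<bar>avg x \<phi> R - avg x' \<phi>' R\<bar> \<le> 2 * \<epsilon> * q ^ card R"
proof -
  let ?e = "\<lambda>W. ((x, flip \<phi> W), (x', flip \<phi>' W))"
  have inj: "inj_on ?e (Pow R)"
    using inj_on_flip[OF assms(1,3)] by (auto simp: inj_on_def)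
  have "?e ` Pow R \<subseteq> arcs_from D" using arc assms(4) by (auto simp: arcs_from_def)
  then have "(\<Sum>e\<in>?e ` Pow R. \<bar>gradient f e\<bar> powr p) \<le> \<epsilon> powr p"
    using energy assms(2) by (simp add: energy_le_def)
  then have "(\<Sum>W\<in>Pow R. \<bar>gradient f (?e W)\<bar> powr p) \<le> \<epsilon> powr p"
    by (subst (asm) sum.reindex[OF inj]) simp
  then have "(\<Sum>W\<in>Pow R. \<bar>gradient f (?e W)\<bar>) / 2 ^ card R \<le> 2 * \<epsilon> * q ^ card R"
    unfolding q_def using assms p_ge_1 eps_pos
    by (intro mean_le_of_sum_powr_le) (auto simp: card_Pow)
  moreover have "avg x \<phi> R - avg x' \<phi>' R = - (\<Sum>W\<in>Pow R. gradient f (?e W)) / 2 ^ card R"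
    by (simp add: avg_def gradient_def sum_subtractf diff_divide_distrib)
  then have "\<bar>avg x \<phi> R - avg x' \<phi>' R\<bar> \<le> (\<Sum>W\<in>Pow R. \<bar>gradient f (?e W)\<bar>) / 2 ^ card R"
    by (auto simp: divide_right_mono)
  ultimately show ?thesis by linarith
qed

lemma avg_walk:
  assumes "(x, y) \<in> parcs H ^^ n" "\<phi> \<in> Conf" "finite R" "R \<subseteq> X" "flip \<phi> ` Pow R \<subseteq> D"
  shows "\<bar>avg x \<phi> R - avg y \<phi> R\<bar> \<le> real n * (2 * \<epsilon> * q ^ card R)"
  using assms(1)
proof (induction n arbitrary: y)
  case (Suc n)
  then obtain z where z: "(x, z) \<in> parcs H ^^ n" "(z, y) \<in> parcs H" by auto
  have "\<bar>avg z \<phi> R - avg y \<phi> R\<bar> \<le> 2 * \<epsilon> * q ^ card R"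
  proof (rule avg_step)
    fix W assume "W \<subseteq> R"
    then show "((z, flip \<phi> W), (y, flip \<phi> W)) \<in> parcs G"
      using assms z by (intro move_arc flip_config) (auto intro: finite_subset)
  qed (use assms in auto)
  with Suc.IH[OF z(1)] show ?case by (simp add: algebra_simps)
qed simp

lemma avg_change_lamp:
  assumes "y \<in> X" "y \<notin> R" "(\<phi> y, b) \<in> parcs L"
    "\<phi> \<in> Conf" "finite R" "R \<subseteq> X" "flip \<phi> ` Pow R \<subseteq> D"
  shows "\<bar>avg y \<phi> R - avg y (\<phi>(y := b)) R\<bar> \<le> 2 * \<epsilon> * q ^ card R"
proof (rule avg_step)
  fix W assume "W \<subseteq> R"
  then have "((y, flip \<phi> W), (y, (flip \<phi> W)(y := b))) \<in> parcs G"
    using assms by (intro lamp_arc flip_config) (auto intro: finite_subset simp: flip_def)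
  then show "((y, flip \<phi> W), (y, flip (\<phi>(y := b)) W)) \<in> parcs G"
    using \<open>W \<subseteq> R\<close> assms by (subst flip_update) auto
qed (use assms in auto)

text \<open>
  Walk from \<open>x\<close> to \<open>y\<close>, randomise the lamp there, and walk back.  Read backwards, the same bound
  is the cost of removing \<open>y\<close> from the randomised sites.
\<close>

lemma avg_insert_near:
  assumes "(x, y) \<in> parcs H ^^ n" "x \<in> X" "y \<in> X"
    "\<phi> \<in> Conf" "finite R" "R \<subseteq> X" "flip \<phi> ` Pow (insert y R) \<subseteq> D"
  shows "\<bar>avg x \<phi> (insert y R) - avg x \<phi> R\<bar> \<le> (2 * real n + 1) * (2 * \<epsilon> * q ^ card R)"
proof (cases "y \<in> R")
  case True
  then show ?thesis using q_pos eps_pos by (simp add: insert_absorb)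
next
  case False
  let ?\<kappa> = "2 * \<epsilon> * q ^ card R"
  have D: "flip \<phi> ` Pow R \<subseteq> D" using assms(7) by blast
  have \<phi>y: "\<phi> y \<in> pverts L" using assms by (auto simp: lamp_configs_def)
  have "\<bar>avg y \<phi> R - avg y (\<phi>(y := other (\<phi> y))) R\<bar> \<le> ?\<kappa>"
    using assms False D \<phi>y other_arc by (intro avg_change_lamp) auto
  then have "\<bar>avg y \<phi> (insert y R) - avg y \<phi> R\<bar> \<le> ?\<kappa>"
    unfolding avg_insert[OF assms(5) False] by (simp add: abs_le_iff field_simps)
  moreover have "\<bar>avg x \<phi> R - avg y \<phi> R\<bar> \<le> real n * ?\<kappa>"
    using assms D by (intro avg_walk)
  moreover have "\<bar>avg x \<phi> (insert y R) - avg y \<phi> (insert y R)\<bar>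
      \<le> real n * (2 * \<epsilon> * q ^ card (insert y R))"
    using assms by (intro avg_walk) auto
  moreover have "real n * (2 * \<epsilon> * q ^ card (insert y R)) \<le> real n * ?\<kappa>"
    using assms False eps_pos by (intro mult_left_mono q_power_mono) auto
  ultimately show ?thesis by (simp add: algebra_simps)
qed

text \<open>
  The bound is uniform in \<open>N\<close> and in the vertex, since the round trip to the \<open>k\<close>-th site has
  length linear in \<open>k\<close> while each of its steps costs \<open>O (q ^ k)\<close>.
\<close>

lemma near_sites_bound:
  assumes "inj s" "range s \<subseteq> X" "\<And>k. \<exists>m\<le>Suc k. (x, s k) \<in> parcs H ^^ m"
    and "x \<in> X" "\<phi> \<in> Conf" "\<And>W. finite W \<Longrightarrow> W \<subseteq> range s \<Longrightarrow> flip \<phi> W \<in> D"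
  shows "\<bar>f (x, \<phi>) - avg x \<phi> (s ` {..<N})\<bar> \<le> 6 * \<epsilon> / (1 - q)\<^sup>2"
proof -
  let ?R = "\<lambda>k. s ` {..<k}"
  have step: "\<bar>avg x \<phi> (?R (Suc k)) - avg x \<phi> (?R k)\<bar> \<le> 6 * \<epsilon> * (of_nat (Suc k) * q ^ k)" for k
  proof -
    obtain m where m: "m \<le> Suc k" "(x, s k) \<in> parcs H ^^ m" using assms(3) by blast
    have "?R (Suc k) = insert (s k) (?R k)" by (simp add: lessThan_Suc)
    moreover have "card (?R k) = k"
      using assms(1) by (simp add: card_image inj_on_subset)
    moreover have "\<bar>avg x \<phi> (insert (s k) (?R k)) - avg x \<phi> (?R k)\<bar>
        \<le> (2 * real m + 1) * (2 * \<epsilon> * q ^ card (?R k))"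
    proof (intro avg_insert_near m)
      show "flip \<phi> ` Pow (insert (s k) (?R k)) \<subseteq> D"
      proof safe
        fix W assume W: "W \<subseteq> insert (s k) (?R k)"
        then have "finite W" by (rule finite_subset) simp
        moreover have "W \<subseteq> range s" using W by auto
        ultimately show "flip \<phi> W \<in> D" by (rule assms(6))
      qed
    qed (use assms in auto)
    \<comment> \<open>From \<open>m \<le> k + 1\<close> one gets \<open>2 * m + 1 \<le> 3 * (k + 1)\<close>, the coefficient
      of the differentiated geometric series.\<close>
    moreover have "(2 * real m + 1) * (2 * \<epsilon> * q ^ k) \<le> (3 * real (Suc k)) * (2 * \<epsilon> * q ^ k)"
      using m q_pos eps_pos by (intro mult_right_mono) auto
    ultimately show ?thesis by (simp add: algebra_simps)
  qed
  have sums: "(\<lambda>k. of_nat (Suc k) * q ^ k) sums (1 / (1 - q)\<^sup>2)"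
    using q_pos q_less_1 by (intro geometric_deriv_sums) auto
  have "\<bar>f (x, \<phi>) - avg x \<phi> (?R N)\<bar> = \<bar>\<Sum>k<N. avg x \<phi> (?R (Suc k)) - avg x \<phi> (?R k)\<bar>"
    by (subst sum_lessThan_telescope) simp
  also have "\<dots> \<le> (\<Sum>k<N. 6 * \<epsilon> * (of_nat (Suc k) * q ^ k))"
    by (intro order_trans[OF sum_abs] sum_mono step)
  also have "\<dots> = 6 * \<epsilon> * (\<Sum>k<N. of_nat (Suc k) * q ^ k)"
    by (simp add: sum_distrib_left)
  also have "\<dots> \<le> 6 * \<epsilon> * (1 / (1 - q)\<^sup>2)"
    using sums q_pos eps_pos sum_le_suminf[OF sums_summable[OF sums], of "{..<N}"]
    by (intro mult_left_mono) (auto simp: sums_iff)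
  finally show ?thesis by simp
qed

end

section \<open>Merging averages with different starting vertices\<close>

lemma (in lamplighter_function) tendsto_quadratic_q:
  "(\<lambda>N. real N * ((real N * a + b) * (c * q ^ N))) \<longlonglongrightarrow> 0"
proof -
  have s: "0 < sqrt q" "sqrt q < 1" using q_pos q_less_1 by auto
  have l1: "(\<lambda>N. real N * sqrt q ^ N) \<longlonglongrightarrow> 0"
    using s by (intro powser_times_n_limit_0) auto
  have l2: "(\<lambda>N. real N * q ^ N) \<longlonglongrightarrow> 0"
    using q_pos q_less_1 by (intro powser_times_n_limit_0) auto
  have "(\<lambda>N. a * c * ((real N * sqrt q ^ N) * (real N * sqrt q ^ N)) + b * c * (real N * q ^ N)) \<longlonglongrightarrow>
      a * c * (0 * 0) + b * c * 0"
    by (intro tendsto_intros l1 l2)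
  moreover have "sqrt q ^ N * sqrt q ^ N = q ^ N" for N
    using q_pos by (simp flip: power_mult_distrib)
  then have "a * c * ((real N * sqrt q ^ N) * (real N * sqrt q ^ N)) + b * c * (real N * q ^ N) =
      real N * ((real N * a + b) * (c * q ^ N))" for N
    by (simp add: algebra_simps)
  ultimately show ?thesis by simp
qed

locale finite_energy = bounded_energy where D = UNIV
begin

text \<open>
  When the lamp that distinguishes \<open>\<phi>\<close> from \<open>\<phi>'\<close> is itself randomised, the two averages run
  over different states of that lamp.  The step then goes through the average with \<open>x\<close> removed
  from \<open>R\<close>, whence three steps and the exponent \<open>card R - 1\<close>.
\<close>

lemma avg_adjacent:
  assumes "((x, \<phi>), (x', \<phi>')) \<in> parcs G" "finite R" "R \<subseteq> X"
  shows "\<bar>avg x \<phi> R - avg x' \<phi>' R\<bar> \<le> 3 * (2 * \<epsilon> * q ^ (card R - 1))"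
proof -
  let ?\<kappa> = "2 * \<epsilon> * q ^ (card R - 1)"
  have \<kappa>: "2 * \<epsilon> * q ^ card R \<le> ?\<kappa>" "0 \<le> ?\<kappa>"
    using q_power_mono[of "card R - 1" "card R"] eps_pos q_pos by auto
  have X: "x \<in> X" "\<phi> \<in> Conf" "\<phi>' \<in> Conf" using assms by (auto simp: arc_G_iff)
  show ?thesis
    using assms(1)
  proof (cases rule: arc_G_cases)
    case (1 y)
    then have "\<bar>avg x \<phi> R - avg x' \<phi>' R\<bar> \<le> real 1 * (2 * \<epsilon> * q ^ card R)"
      using assms X avg_walk[of x y 1 \<phi> R] by simp
    then show ?thesis using \<kappa> by simp
  next
    case (2 b)
    then have "x' = x" by simp
    define R' where "R' = R - {x}"
    have R': "finite R'" "R' \<subseteq> X" "x \<notin> R'" using assms by (auto simp: R'_def)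
    have change: "\<bar>avg x \<phi> R' - avg x' \<phi>' R'\<bar> \<le> 2 * \<epsilon> * q ^ card R'"
      using 2 avg_change_lamp[of x R' \<phi> b] R' X by auto
    show ?thesis
    proof (cases "x \<in> R")
      case True
      then have R: "insert x R' = R" and card: "card R - 1 = card R'"
        using assms by (auto simp: R'_def)
      have "\<bar>avg x \<psi> R - avg x \<psi> R'\<bar> \<le> ?\<kappa>" if "\<psi> \<in> Conf" for \<psi>
        unfolding card using avg_insert_near[of x x 0 \<psi> R'] that X R' by (simp add: R)
      from this[OF X(2)] this[OF X(3)] change show ?thesis
        unfolding card \<open>x' = x\<close> by linarith
    next
      case False
      then have "R' = R" by (simp add: R'_def)
      then show ?thesis using change \<kappa> by simp
    qed
  qed
qed

text \<open>
  With the same growing sets of randomised sites, the starting vertex is forgotten in the limit: a path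
  from \<open>u\<close> to \<open>v\<close> has a fixed length, and each of its steps becomes negligible.
\<close>

lemma avg_diff_tendsto:
  assumes "u \<in> pverts G" "v \<in> pverts G"
    and R: "\<And>N. finite (R N)" "\<And>N. R N \<subseteq> X" "\<And>N. N \<le> card (R N)"
  shows "(\<lambda>N. avg (fst u) (snd u) (R N) - avg (fst v) (snd v) (R N)) \<longlonglongrightarrow> 0"
  using G_rtrancl[OF assms(1,2)]
proof induction
  case (step v w)
  let ?d = "\<lambda>u v N. avg (fst u) (snd u) (R N) - avg (fst v) (snd v) (R N)"
  have "(\<lambda>N. 6 * \<epsilon> * q ^ (N - 1)) \<longlonglongrightarrow> 6 * \<epsilon> * 0"
    using q_pos q_less_1
    by (intro tendsto_intros filterlim_compose[OF LIMSEQ_power_zero] filterlim_minus_const_nat_at_top)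
       auto
  then have lim: "(\<lambda>N. 6 * \<epsilon> * q ^ (N - 1)) \<longlonglongrightarrow> 0" by simp
  have "?d v w \<longlonglongrightarrow> 0"
  proof (rule Lim_null_comparison[OF _ lim])
    have "\<bar>?d v w N\<bar> \<le> 6 * \<epsilon> * q ^ (N - 1)" for N
    proof -
      have "\<bar>?d v w N\<bar> \<le> 3 * (2 * \<epsilon> * q ^ (card (R N) - 1))"
        using step R by (intro avg_adjacent) auto
      also have "\<dots> \<le> 3 * (2 * \<epsilon> * q ^ (N - 1))"
        using eps_pos R(3)[of N] by (intro mult_left_mono q_power_mono) auto
      finally show ?thesis by simp
    qed
    then show "\<forall>\<^sub>F N in sequentially. norm (?d v w N) \<le> 6 * \<epsilon> * q ^ (N - 1)" by simp
  qed
  from tendsto_add[OF step.IH this] show ?case by simp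
qed simp

lemma avg_union:
  assumes "finite Q" "Q \<subseteq> X" "\<And>y. y \<in> Q \<Longrightarrow> \<exists>m\<le>n. (x, y) \<in> parcs H ^^ m"
    and "x \<in> X" "\<phi> \<in> Conf" "finite R" "R \<subseteq> X"
  shows "\<bar>avg x \<phi> (R \<union> Q) - avg x \<phi> R\<bar> \<le> real (card Q) * ((2 * real n + 1) * (2 * \<epsilon> * q ^ card R))"
  using assms(1-3)
proof induction
  case (insert y Q)
  obtain m where m: "m \<le> n" "(x, y) \<in> parcs H ^^ m" using insert.prems by blast
  have "\<bar>avg x \<phi> (insert y (R \<union> Q)) - avg x \<phi> (R \<union> Q)\<bar>
      \<le> (2 * real m + 1) * (2 * \<epsilon> * q ^ card (R \<union> Q))"
    using m insert assms by (intro avg_insert_near) auto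
  also have "\<dots> \<le> (2 * real n + 1) * (2 * \<epsilon> * q ^ card R)"
    using m eps_pos q_pos insert assms
    by (intro mult_mono mult_left_mono q_power_mono card_mono) auto
  finally show ?case using insert by (simp add: algebra_simps)
qed simp

lemma avg_union_tendsto:
  assumes "x \<in> X" "\<phi> \<in> Conf"
    and R: "\<And>N. finite (R N)" "\<And>N. R N \<subseteq> X" "\<And>N. N \<le> card (R N)"
    and t: "inj t" "range t \<subseteq> X" "\<And>k. \<exists>m\<le>K + Suc k. (x, t k) \<in> parcs H ^^ m"
  shows "(\<lambda>N. avg x \<phi> (R N \<union> t ` {..<N}) - avg x \<phi> (R N)) \<longlonglongrightarrow> 0"
proof (rule Lim_null_comparison)
  show "(\<lambda>N. real N * ((real N * 2 + (2 * real K + 1)) * ((2 * \<epsilon>) * q ^ N))) \<longlonglongrightarrow> 0"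
    by (rule tendsto_quadratic_q)
  have "\<bar>avg x \<phi> (R N \<union> t ` {..<N}) - avg x \<phi> (R N)\<bar>
     \<le> real N * ((real N * 2 + (2 * real K + 1)) * ((2 * \<epsilon>) * q ^ N))" for N
  proof -
    have c: "card (t ` {..<N}) = N" using t(1) by (simp add: card_image inj_on_subset)
    have "\<exists>m\<le>K + N. (x, y) \<in> parcs H ^^ m" if y: "y \<in> t ` {..<N}" for y
    proof -
      obtain k where k: "k < N" "y = t k" using y by auto
      then obtain m where "m \<le> K + Suc k" "(x, y) \<in> parcs H ^^ m" using t(3) by blast
      then show ?thesis using k by (intro exI[of _ m]) auto
    qed
    then have "\<bar>avg x \<phi> (R N \<union> t ` {..<N}) - avg x \<phi> (R N)\<bar>
        \<le> real (card (t ` {..<N})) * ((2 * real (K + N) + 1) * (2 * \<epsilon> * q ^ card (R N)))"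
      using assms by (intro avg_union) auto
    also have "\<dots> \<le> real N * ((2 * real (K + N) + 1) * (2 * \<epsilon> * q ^ N))"
      unfolding c using R(3)[of N] eps_pos by (intro mult_left_mono q_power_mono) auto
    finally show ?thesis by (simp add: algebra_simps)
  qed
  then show "\<forall>\<^sub>F N in sequentially. norm (avg x \<phi> (R N \<union> t ` {..<N}) - avg x \<phi> (R N))
      \<le> real N * ((real N * 2 + (2 * real K + 1)) * ((2 * \<epsilon>) * q ^ N))"
    by simp
qed

end
lemma (in lamplighter_function) relpow_in_X: "(x, y) \<in> parcs H ^^ m \<Longrightarrow> x \<in> X \<Longrightarrow> y \<in> X"
  by (cases m) (use H_arc_ends in fastforce)+

text \<open>
  The union \<open>?R N\<close> of the two families of sites serves as a common set.  The sites near \<open>y\<close> are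
  still at distance at most \<open>K + k + 1\<close> from \<open>x\<close>, where \<open>K\<close> is the length of a walk from
  \<open>x\<close> to \<open>y\<close>; this keeps the cost of adding them quadratic in \<open>N\<close>, against the factor
  \<open>q ^ N\<close>.
\<close>

lemma (in finite_energy) avg_sites_tendsto:
  assumes "x \<in> X" "\<phi> \<in> Conf" "y \<in> X" "\<psi> \<in> Conf"
    and s: "inj s" "\<And>k. \<exists>m\<le>Suc k. (x, s k) \<in> parcs H ^^ m"
    and t: "inj t" "\<And>k. \<exists>m\<le>Suc k. (y, t k) \<in> parcs H ^^ m"
  shows "(\<lambda>N. avg x \<phi> (s ` {..<N}) - avg y \<psi> (t ` {..<N})) \<longlonglongrightarrow> 0"
proof -
  have detour: "\<exists>K. \<forall>k. \<exists>m\<le>K + Suc k. (a, w k) \<in> parcs H ^^ m"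
    if ab: "a \<in> X" "b \<in> X" and w: "\<And>k. \<exists>m\<le>Suc k. (b, w k) \<in> parcs H ^^ m" for a b and w :: "nat \<Rightarrow> 'a"
  proof -
    have "(a, b) \<in> (parcs H)\<^sup>*"
      using ab connected_rtrancl[OF H.pair_bidirected_digraph_axioms H_connected] by blast
    then obtain K where K: "(a, b) \<in> parcs H ^^ K" by (auto dest: rtrancl_imp_relpow)
    have "\<exists>m\<le>K + Suc k. (a, w k) \<in> parcs H ^^ m" for k
    proof -
      obtain m where "m \<le> Suc k" "(b, w k) \<in> parcs H ^^ m" using w by blast
      then show ?thesis using K by (intro exI[of _ "K + m"]) (auto simp: relpow_add)
    qed
    then show ?thesis by blast
  qed
  have ranges: "range s \<subseteq> X" "range t \<subseteq> X"
    using s(2) t(2) relpow_in_X assms(1,3) by blast+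
  have cards: "card (s ` {..<N}) = N" "card (t ` {..<N}) = N" for N
    using s t by (auto simp: card_image inj_on_subset)
  let ?R = "\<lambda>N. s ` {..<N} \<union> t ` {..<N}"
  obtain K where "\<And>k. \<exists>m\<le>K + Suc k. (x, t k) \<in> parcs H ^^ m"
    using detour[OF assms(1,3) t(2)] by blast
  then have 1: "(\<lambda>N. avg x \<phi> (?R N) - avg x \<phi> (s ` {..<N})) \<longlonglongrightarrow> 0"
    using assms ranges cards by (intro avg_union_tendsto) auto
  obtain K' where "\<And>k. \<exists>m\<le>K' + Suc k. (y, s k) \<in> parcs H ^^ m"
    using detour[OF assms(3,1) s(2)] by blast
  then have "(\<lambda>N. avg y \<psi> (t ` {..<N} \<union> s ` {..<N}) - avg y \<psi> (t ` {..<N})) \<longlonglongrightarrow> 0"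
    using assms ranges cards by (intro avg_union_tendsto) auto
  then have 2: "(\<lambda>N. avg y \<psi> (?R N) - avg y \<psi> (t ` {..<N})) \<longlonglongrightarrow> 0"
    by (simp add: Un_commute)
  have "N \<le> card (?R N)" for N
    using card_mono[of "?R N" "s ` {..<N}"] cards by auto
  then have 3: "(\<lambda>N. avg x \<phi> (?R N) - avg y \<psi> (?R N)) \<longlonglongrightarrow> 0"
    using avg_diff_tendsto[of "(x, \<phi>)" "(y, \<psi>)" ?R] assms(1-4) ranges
    by (simp add: pverts_G image_subset_iff)
  show ?thesis using tendsto_add[OF tendsto_diff[OF 3 1] 2] by simp
qed

section \<open>Constancy at infinity\<close>

context lamplighter_function
begin

text \<open>
  A marker tells \<open>\<phi>\<close> apart, at a single site, from every configuration in which an arc of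
  \<open>T\<close> starts.  A configuration that merely differs from each of them, but at varying sites, could
  be changed into one of them by the randomisation.
\<close>

definition marked :: "(('a \<times> ('a \<Rightarrow> 'b)) \<times> ('a \<times> ('a \<Rightarrow> 'b))) set \<Rightarrow> ('a \<Rightarrow> 'b) \<Rightarrow> bool" where
  "marked T \<phi> \<longleftrightarrow> (\<exists>z\<in>X. \<forall>e\<in>T. snd (fst e) z \<noteq> \<phi> z)"

lemma marked_sites:
  assumes "infinite X" "energy_le p (parcs G - T) (gradient f) \<epsilon>" "0 < \<epsilon>"
    and "x \<in> X" "\<phi> \<in> Conf" "marked T \<phi>"
  obtains s where "inj s" "\<And>k. \<exists>m\<le>Suc k. (x, s k) \<in> parcs H ^^ m"
    "\<And>N. \<bar>f (x, \<phi>) - avg x \<phi> (s ` {..<N})\<bar> \<le> 6 * \<epsilon> / (1 - q)\<^sup>2"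
proof -
  obtain z where z: "z \<in> X" "\<And>e. e \<in> T \<Longrightarrow> snd (fst e) z \<noteq> \<phi> z"
    using assms(6) by (auto simp: marked_def)
  have reach: "(x, y) \<in> (parcs H)\<^sup>*" if "y \<in> X" for y
    using that assms connected_rtrancl[OF H.pair_bidirected_digraph_axioms H_connected] by blast
  obtain s where s: "inj s" "\<And>k. s k \<noteq> z" "\<And>k. \<exists>m\<le>Suc k. (x, s k) \<in> parcs H ^^ m"
    using exists_near_sites[OF reach assms(1)] by blast
  define D where "D = {\<psi>. \<psi> z = \<phi> z}"
  have "arcs_from D \<subseteq> parcs G - T" using z by (auto simp: arcs_from_def D_def)
  then have "energy_le p (arcs_from D) (gradient f) \<epsilon>" by (rule energy_le_mono[OF assms(2)])
  then interpret bounded_energy H L r p f D \<epsilon> by unfold_locales (use assms in auto)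
  have "\<bar>f (x, \<phi>) - avg x \<phi> (s ` {..<N})\<bar> \<le> 6 * \<epsilon> / (1 - q)\<^sup>2" for N
  proof (rule near_sites_bound[OF s(1) _ s(3)])
    show "range s \<subseteq> X" using s(3) relpow_in_X assms(4) by blast
    show "flip \<phi> W \<in> D" if "W \<subseteq> range s" for W
      using that s(2) by (auto simp: D_def intro!: flip_other)
  qed (use assms in auto)
  then show thesis using that s by blast
qed

text \<open>
  The smallness of \<open>\<epsilon>\<close> enters only through the uniform bound between a value and its averages.
  The merging of the averages may meet arcs of \<open>T\<close>, and uses the total energy instead.
\<close>

lemma marked_close:
  assumes "infinite X" "in_ell_p p (parcs G) (gradient f)"
    and "energy_le p (parcs G - T) (gradient f) \<epsilon>" "0 < \<epsilon>"
    and "x \<in> X" "\<phi> \<in> Conf" "marked T \<phi>" "y \<in> X" "\<psi> \<in> Conf" "marked T \<psi>"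
  shows "\<bar>f (x, \<phi>) - f (y, \<psi>)\<bar> \<le> 12 * \<epsilon> / (1 - q)\<^sup>2"
proof -
  obtain E where "0 < E" "energy_le p (parcs G) (gradient f) E"
    using energy_le_total[OF assms(2) p_ge_1] by blast
  then interpret finite_energy H L r p f E
    by unfold_locales (auto simp: arcs_from_def)
  let ?B = "6 * \<epsilon> / (1 - q)\<^sup>2"
  obtain s where s: "inj s" "\<And>k. \<exists>m\<le>Suc k. (x, s k) \<in> parcs H ^^ m"
    "\<And>N. \<bar>f (x, \<phi>) - avg x \<phi> (s ` {..<N})\<bar> \<le> ?B"
    using marked_sites[OF assms(1,3,4,5,6,7)] by blast
  obtain t where t: "inj t" "\<And>k. \<exists>m\<le>Suc k. (y, t k) \<in> parcs H ^^ m"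
    "\<And>N. \<bar>f (y, \<psi>) - avg y \<psi> (t ` {..<N})\<bar> \<le> ?B"
    using marked_sites[OF assms(1,3,4,8,9,10)] by blast
  let ?d = "\<lambda>N. avg x \<phi> (s ` {..<N}) - avg y \<psi> (t ` {..<N})"
  have "?d \<longlonglongrightarrow> 0" using assms s t by (intro avg_sites_tendsto)
  then have "(\<lambda>N. \<bar>?d N\<bar> + 2 * ?B) \<longlonglongrightarrow> \<bar>0\<bar> + 2 * ?B" by (intro tendsto_intros)
  moreover have "\<bar>f (x, \<phi>) - f (y, \<psi>)\<bar> \<le> \<bar>?d N\<bar> + 2 * ?B" for N
    using s(3)[of N] t(3)[of N] by linarith
  ultimately have "\<bar>f (x, \<phi>) - f (y, \<psi>)\<bar> \<le> \<bar>0\<bar> + 2 * ?B"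
    by (intro LIMSEQ_le_const) auto
  then show ?thesis by simp
qed

text \<open>
  Let \<open>A\<close> collect the positions and the lit sites of the vertices at which arcs of \<open>T\<close> start.
  An unmarked configuration agrees at every site with one of finitely many configurations that are all
  dark outside \<open>A\<close>, so there are only finitely many of them.  At a position outside \<open>A\<close>,
  lighting the lamp there creates a marker.
\<close>

lemma nearly_marked_cofinite:
  assumes "finite T" "T \<subseteq> parcs G"
  obtains S where "finite S"
    "\<And>x \<phi>. x \<in> X \<Longrightarrow> \<phi> \<in> Conf \<Longrightarrow> (x, \<phi>) \<notin> S \<Longrightarrow> \<not> marked T \<phi> \<Longrightarrow>
      \<exists>\<psi>\<in>Conf. marked T \<psi> \<and> ((x, \<phi>), (x, \<psi>)) \<in> parcs G - T"
proof -
  define A where "A = (\<Union>e\<in>T. insert (fst (fst e)) {y \<in> X. snd (fst e) y \<noteq> r})"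
  have "finite A"
    unfolding A_def using assms parcs_G_subset
    by (intro finite_UN_I) (auto simp: pverts_G lamp_configs_def)
  define U where "U = {\<phi> \<in> Conf. \<not> marked T \<phi>}"
  have dark: "\<phi> z = r" if "\<phi> \<in> U" "z \<in> X" "z \<notin> A" for \<phi> z
    using that by (fastforce simp: U_def marked_def A_def)
  let ?B = "\<lambda>z. (\<lambda>e. snd (fst e) z) ` T"
  let ?ext = "\<lambda>g y. if y \<in> A then g y else if y \<in> X then r else undefined"
  have "A \<subseteq> X" using assms parcs_G_subset by (force simp: A_def pverts_G)
  have "U \<subseteq> ?ext ` Pi\<^sub>E A ?B"
  proof
    fix \<phi> assume \<phi>: "\<phi> \<in> U"
    then have "\<phi> y = undefined" if "y \<notin> X" for y
      using that by (auto simp: U_def lamp_configs_def PiE_def extensional_def)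
    then have "\<phi> = ?ext (restrict \<phi> A)" using dark[OF \<phi>] by (auto simp: fun_eq_iff)
    moreover have "restrict \<phi> A \<in> Pi\<^sub>E A ?B"
    proof (intro restrict_PiE_iff[THEN iffD2] ballI)
      fix z assume "z \<in> A"
      then have "z \<in> X" using \<open>A \<subseteq> X\<close> by blast
      then obtain e where "e \<in> T" "snd (fst e) z = \<phi> z"
        using \<phi> by (auto simp: U_def marked_def)
      then show "\<phi> z \<in> ?B z" by (intro image_eqI[of _ _ e]) auto
    qed
    ultimately show "\<phi> \<in> ?ext ` Pi\<^sub>E A ?B" by blast
  qed
  moreover have "finite (Pi\<^sub>E A ?B)" using \<open>finite A\<close> assms by (intro finite_PiE) auto
  ultimately have "finite U" by (meson finite_imageI finite_subset)
  then have fin: "finite (A \<times> U)" using \<open>finite A\<close> by simp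
  have "\<exists>\<psi>\<in>Conf. marked T \<psi> \<and> ((x, \<phi>), (x, \<psi>)) \<in> parcs G - T"
    if x: "x \<in> X" "\<phi> \<in> Conf" "(x, \<phi>) \<notin> A \<times> U" "\<not> marked T \<phi>" for x \<phi>
  proof -
    have "\<phi> \<in> U" "x \<notin> A" using x by (auto simp: U_def)
    then have \<phi>x: "\<phi> x = r" using dark x by blast
    let ?\<psi> = "\<phi>(x := other r)"
    have arc: "((x, \<phi>), (x, ?\<psi>)) \<in> parcs G"
      using x \<phi>x other_arc[OF root] by (intro lamp_arc) auto
    moreover have "((x, \<phi>), (x, ?\<psi>)) \<notin> T" using \<open>x \<notin> A\<close> by (force simp: A_def)
    moreover have "snd (fst e) x = r" if "e \<in> T" for e
      using \<open>x \<notin> A\<close> that x by (auto simp: A_def)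
    then have "marked T ?\<psi>"
      using x other_neq[OF root] by (auto simp: marked_def intro!: bexI[of _ x])
    moreover have "?\<psi> \<in> Conf" using arc by (auto simp: arc_G_iff)
    ultimately show ?thesis by blast
  qed
  then show thesis using that fin by blast
qed

text \<open>
  The constant \<open>K\<close> adds two steps from the given vertices to marked ones to the bound between
  marked vertices.
\<close>

lemma nearly_constant_off_finite:
  assumes "infinite X" "in_ell_p p (parcs G) (gradient f)" "0 < \<eta>"
  obtains S where "finite S" "\<And>u v. u \<in> pverts G - S \<Longrightarrow> v \<in> pverts G - S \<Longrightarrow> \<bar>f u - f v\<bar> \<le> \<eta>"
proof -
  define K where "K = 12 / (1 - q)\<^sup>2 + 2"
  define \<epsilon> where "\<epsilon> = \<eta> / K"
  have "0 < K" by (simp add: K_def add_nonneg_pos)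
  then have \<epsilon>: "0 < \<epsilon>" "K * \<epsilon> = \<eta>" using assms by (auto simp: \<epsilon>_def)
  obtain T where T: "finite T" "T \<subseteq> parcs G" "energy_le p (parcs G - T) (gradient f) \<epsilon>"
    using energy_le_tail[OF assms(2) \<epsilon>(1)] by blast
  obtain S where S: "finite S"
    "\<And>x \<phi>. x \<in> X \<Longrightarrow> \<phi> \<in> Conf \<Longrightarrow> (x, \<phi>) \<notin> S \<Longrightarrow> \<not> marked T \<phi> \<Longrightarrow>
      \<exists>\<psi>\<in>Conf. marked T \<psi> \<and> ((x, \<phi>), (x, \<psi>)) \<in> parcs G - T"
    using nearly_marked_cofinite[OF T(1,2)] by blast
  have near: "\<exists>x \<psi>. x \<in> X \<and> \<psi> \<in> Conf \<and> marked T \<psi> \<and> \<bar>f u - f (x, \<psi>)\<bar> \<le> \<epsilon>"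
    if u: "u \<in> pverts G - S" for u
  proof -
    obtain x \<phi> where x: "u = (x, \<phi>)" "x \<in> X" "\<phi> \<in> Conf" using u by (auto simp: pverts_G)
    show ?thesis
    proof (cases "marked T \<phi>")
      case True
      then show ?thesis using x \<epsilon> by (intro exI[of _ x] exI[of _ \<phi>]) auto
    next
      case False
      then obtain \<psi> where \<psi>: "\<psi> \<in> Conf" "marked T \<psi>" "(u, (x, \<psi>)) \<in> parcs G - T"
        using S(2)[of x \<phi>] x u by auto
      then have "(\<Sum>e\<in>{(u, (x, \<psi>))}. \<bar>gradient f e\<bar> powr p) \<le> \<epsilon> powr p"
        using T(3) unfolding energy_le_def by blast
      then have "\<bar>f (x, \<psi>) - f u\<bar> \<le> \<epsilon>"
        using powr_less_mono2[of p \<epsilon> "\<bar>f (x, \<psi>) - f u\<bar>"] p_ge_1 \<epsilon>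
        by (force simp: gradient_def)
      then show ?thesis using \<psi> x by (intro exI[of _ x] exI[of _ \<psi>]) auto
    qed
  qed
  have "\<bar>f u - f v\<bar> \<le> \<eta>" if uv: "u \<in> pverts G - S" "v \<in> pverts G - S" for u v
  proof -
    obtain x \<phi> where 1: "x \<in> X" "\<phi> \<in> Conf" "marked T \<phi>" "\<bar>f u - f (x, \<phi>)\<bar> \<le> \<epsilon>"
      using near[OF uv(1)] by blast
    obtain y \<psi> where 2: "y \<in> X" "\<psi> \<in> Conf" "marked T \<psi>" "\<bar>f v - f (y, \<psi>)\<bar> \<le> \<epsilon>"
      using near[OF uv(2)] by blast
    have "\<bar>f (x, \<phi>) - f (y, \<psi>)\<bar> \<le> 12 * \<epsilon> / (1 - q)\<^sup>2"
      using assms T \<epsilon> 1 2 by (intro marked_close)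
    moreover have "\<eta> = 12 * \<epsilon> / (1 - q)\<^sup>2 + 2 * \<epsilon>"
      unfolding \<epsilon>(2)[symmetric] K_def by (simp add: algebra_simps)
    ultimately show ?thesis using 1 2 by linarith
  qed
  then show thesis using that S by blast
qed

lemma infinite_pverts_G:
  assumes "infinite X"
  shows "infinite (pverts G)"
proof -
  have "(\<lambda>y\<in>X. r) \<in> Conf" using root by (auto simp: lamp_configs_def)
  then show ?thesis using assms by (auto simp: pverts_G finite_cartesian_product_iff)
qed

end

theorem proposition1:
  fixes H :: "'a pair_pre_digraph" and L :: "'b pair_pre_digraph"
    and r :: 'b and p :: real and f :: "'a \<times> ('a \<Rightarrow> 'b) \<Rightarrow> real"
  assumes "pair_bidirected_digraph H" "Digraph_Component.connected (with_proj H)"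
    and "locally_finite H"
    and "pair_bidirected_digraph L" "Digraph_Component.connected (with_proj L)"
    and "locally_finite L"
    and "infinite (pverts H)" "at_most_two_ends H"
    and "parcs L \<noteq> {}" "at_most_two_ends L"
    and "r \<in> pverts L"
    and "1 \<le> p"
    and "harmonic (lamplighter L r H) f"
    and "in_ell_p p (parcs (lamplighter L r H)) (gradient f)"
  shows "f constant_on pverts (lamplighter L r H)"
proof -
  interpret H: pair_bidirected_digraph H by fact
  interpret L: pair_bidirected_digraph L by fact
  interpret lamplighter_function H L r p f by unfold_locales (use assms in auto)
  note max = maximum_principle[OF _ parcs_G_subset finite_neighbours_G[OF assms(3,6)] G_rtrancl]
  have close: "\<bar>f a - f b\<bar> \<le> 2 * \<eta>" if "0 < \<eta>" and ab: "a \<in> pverts G" "b \<in> pverts G" for \<eta> a b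
  proof -
    obtain S where S: "finite S"
      "\<And>u v. u \<in> pverts G - S \<Longrightarrow> v \<in> pverts G - S \<Longrightarrow> \<bar>f u - f v\<bar> \<le> \<eta>"
      using nearly_constant_off_finite[OF assms(7,14) \<open>0 < \<eta>\<close>] by blast
    obtain w where w: "w \<in> pverts G - S"
      using infinite_pverts_G[OF assms(7)] S(1) by (metis Diff_infinite_finite finite.emptyI ex_in_conv)
    have "{v \<in> pverts G. f w + \<eta> < f v} \<subseteq> S" "{v \<in> pverts G. - f w + \<eta> < - f v} \<subseteq> S"
      using S(2)[OF _ w] by force+
    then have "f u \<le> f w + \<eta>" "- f u \<le> - f w + \<eta>" if "u \<in> pverts G" for u
      using max[OF assms(13), of w "f w + \<eta>" u]
        max[OF harmonic_uminus[OF assms(13)], of w "- f w + \<eta>" u]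
        w that S(1) \<open>0 < \<eta>\<close> by (auto intro: finite_subset)
    from this[OF ab(1)] this[OF ab(2)] show ?thesis by linarith
  qed
  have const: "f a = f b" if ab: "a \<in> pverts G" "b \<in> pverts G" for a b
  proof -
    have "\<bar>f a - f b\<bar> \<le> 0 + e" if "0 < e" for e
      using close[of "e / 2" a b] that ab by simp
    then have "\<bar>f a - f b\<bar> \<le> 0" by (rule field_le_epsilon)
    then show ?thesis by simp
  qed
  have "pverts G \<noteq> {}" using infinite_pverts_G[OF assms(7)] by (rule infinite_imp_nonempty)
  then obtain a where "a \<in> pverts G" by blast
  then have "\<forall>b\<in>pverts G. f b = f a" using const by blast
  then show ?thesis unfolding constant_on_def by (rule exI)
qed

end
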